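(* Let $A\in\mathbb{R}^{m\times N}$, let $k$ be an integer with $1\le k\le N$, let $\|\cdot\|_X$ be a norm on $\mathbb{R}^N$, and let $C_0>0$ be a constant. (i) (Sufficient condition.) Suppose that for any $I\subseteq\{1,\dots,m\}$ and any $\eta_1\in\mathcal{N}(A_I)$, $\eta_2\in\mathcal{N}(A_{I^c})$ we have $$\min\{\|\eta_1\|_X,\|\eta_2\|_X\}\le\frac{C_0}{4}\sigma_k(\eta_1-\eta_2)_X+\frac{C_0}{4}\sigma_k(\eta_1+\eta_2)_X.$$ Then there exists a decoder $\Delta:\mathbb{R}^m\to\mathbb{R}^N$ such that $(A,\Delta)$ is phaseless instance optimal of order $k$ with constant $C_0$ with respect to $\|\cdot\|_X$. (ii) (Necessary condition.) Suppose that there exists a decoder $\Delta:\mathbb{R}^m\to\mathbb{R}^N$ such that $(A,\Delta)$ is phaseless instance optimal of order $k$ with constant $C_0$ with respect to $\|\cdot\|_X$. Then for any $I\subseteq\{1,\dots,m\}$ and any $\eta_1\in\mathcal{N}(A_I)$, $\eta_2\in\mathcal{N}(A_{I^c})$ we have $$\min\{\|\eta_1\|_X,\|\eta_2\|_X\}\le\frac{C_0}{2}\sigma_k(\eta_1-\eta_2)_X+\frac{C_0}{2}\sigma_k(\eta_1+\eta_2)_X.$$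
   Context: $\Sigma_k:=\{x\in\mathbb{R}^N:\|x\|_0\le k\}$, where $\|x\|_0$ is the number of nonzero entries, and $\sigma_k(x)_X:=\min_{z\in\Sigma_k}\|x-z\|_X$. For $y\in\mathbb{R}^m$, $|y|$ denotes the vector of entrywise absolute values. For $I\subseteq\{1,\dots,m\}$, $A_I$ is the submatrix of $A$ keeping only the rows with indices in $I$, $I^c$ is the complement of $I$ in $\{1,\dots,m\}$, and $\mathcal{N}(A_I):=\{\eta\in\mathbb{R}^N:A_I\eta=0\}$ (all of $\mathbb{R}^N$ if $I=\emptyset$). A decoder is any map $\Delta:\mathbb{R}^m\to\mathbb{R}^N$. The pair $(A,\Delta)$ is phaseless instance optimal of order $k$ with constant $C_0$ with respect to $\|\cdot\|_X$ if for all $x\in\mathbb{R}^N$ $$\min\bigl\{\|x-\Delta(|Ax|)\|_X,\ \|x+\Delta(|Ax|)\|_X\bigr\}\le C_0\,\sigma_k(x)_X.$$ *)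

theory Defs
  imports "HOL-Analysis.Analysis"
begin

definition is_norm :: "('a::real_vector \<Rightarrow> real) \<Rightarrow> bool" where
  "is_norm nX \<longleftrightarrow>
     (\<forall>x. 0 \<le> nX x) \<and> (\<forall>x. nX x = 0 \<longleftrightarrow> x = 0) \<and>
     (\<forall>c x. nX (c *\<^sub>R x) = \<bar>c\<bar> * nX x) \<and> (\<forall>x y. nX (x + y) \<le> nX x + nX y)"

definition l0 :: "real ^ 'n \<Rightarrow> nat" where
  "l0 x = card {i. x $ i \<noteq> 0}"

definition sparse :: "nat \<Rightarrow> (real ^ 'n) set" where
  "sparse k = {x. l0 x \<le> k}"

(* The infimum is attained when nX is a norm: see best_approx_attained below. *)
definition best_approx :: "nat \<Rightarrow> (real ^ 'n \<Rightarrow> real) \<Rightarrow> real ^ 'n \<Rightarrow> real" where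
  "best_approx k nX x = (INF z\<in>sparse k. nX (x - z))"

(* The kernel of the submatrix A_I: the entries of A_I \<eta> are those of A \<eta> with index in I. *)
definition null_rows :: "real ^ 'n ^ 'm \<Rightarrow> 'm set \<Rightarrow> (real ^ 'n) set" where
  "null_rows A I = {\<eta>. \<forall>i\<in>I. (A *v \<eta>) $ i = 0}"

(* On vectors, the library's absolute value is entrywise (abs_vec_def). *)
definition phaseless_instance_optimal ::
  "real ^ 'n ^ 'm \<Rightarrow> (real ^ 'm \<Rightarrow> real ^ 'n) \<Rightarrow> nat \<Rightarrow> real \<Rightarrow> (real ^ 'n \<Rightarrow> real) \<Rightarrow> bool" where
  "phaseless_instance_optimal A \<Delta> k C0 nX \<longleftrightarrow>
     (\<forall>x. min (nX (x - \<Delta> \<bar>A *v x\<bar>)) (nX (x + \<Delta> \<bar>A *v x\<bar>)) \<le> C0 * best_approx k nX x)"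

lemma is_norm_continuous:
  fixes nX :: "'a::euclidean_space \<Rightarrow> real"
  assumes "is_norm nX"
  shows "continuous_on UNIV nX"
proof -
  have "convex_on UNIV nX"
  proof (rule convex_onI)
    fix t :: real and x y :: 'a
    assume t: "0 < t" "t < 1"
    have "nX ((1 - t) *\<^sub>R x + t *\<^sub>R y) \<le> nX ((1 - t) *\<^sub>R x) + nX (t *\<^sub>R y)"
      using assms unfolding is_norm_def by blast
    also have "\<dots> = \<bar>1 - t\<bar> * nX x + \<bar>t\<bar> * nX y"
      using assms unfolding is_norm_def by presburger
    also have "\<dots> = (1 - t) * nX x + t * nX y"
      using t by simp
    finally show "nX ((1 - t) *\<^sub>R x + t *\<^sub>R y) \<le> (1 - t) * nX x + t * nX y" .
  qed simp
  then show ?thesis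
    by (intro convex_on_continuous) auto
qed

lemma is_norm_lower_bound:
  fixes nX :: "'a::euclidean_space \<Rightarrow> real"
  assumes "is_norm nX"
  obtains c where "c > 0" "\<And>x. c * norm x \<le> nX x"
proof -
  have "continuous_on (sphere 0 1) nX"
    using is_norm_continuous[OF assms] continuous_on_subset by blast
  moreover have "sphere (0::'a) 1 \<noteq> {}" by simp
  ultimately obtain u where u: "u \<in> sphere 0 1" "\<And>y. y \<in> sphere 0 1 \<Longrightarrow> nX u \<le> nX y"
    using continuous_attains_inf[of "sphere 0 1" nX] by auto
  have "u \<noteq> 0" using u(1) by auto
  then have "nX u > 0"
    using assms unfolding is_norm_def by (metis order_le_less)
  moreover have "nX u * norm x \<le> nX x" for x
  proof (cases "x = 0")
    case True
    then show ?thesis using assms by (simp add: is_norm_def)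
  next
    case False
    have "nX u \<le> nX ((1 / norm x) *\<^sub>R x)"
      using False by (intro u(2)) simp
    also have "\<dots> = nX x / norm x"
      using assms by (simp add: is_norm_def)
    finally show ?thesis using False by (simp add: field_simps)
  qed
  ultimately show thesis by (rule that)
qed

lemma closed_sparse: "closed (sparse k :: (real ^ 'n) set)"
proof -
  have "sparse k = (\<Union>S\<in>{S::'n set. card S \<le> k}. \<Inter>i\<in>-S. {x::real^'n. x $ i = 0})"
    (is "_ = ?U")
  proof (rule set_eqI, rule iffI)
    fix x :: "real ^ 'n"
    assume "x \<in> sparse k"
    then show "x \<in> ?U"
      by (intro UN_I[of "{i. x $ i \<noteq> 0}"]) (auto simp: sparse_def l0_def)
  next
    fix x :: "real ^ 'n"
    assume "x \<in> ?U"
    then obtain S :: "'n set" where S: "card S \<le> k" "\<And>i. i \<notin> S \<Longrightarrow> x $ i = 0"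
      by auto
    then have "card {i. x $ i \<noteq> 0} \<le> card S"
      by (intro card_mono) auto
    with S(1) show "x \<in> sparse k" by (simp add: sparse_def l0_def)
  qed
  moreover have "closed ?U"
    by (intro closed_UN closed_INT ballI closed_Collect_eq continuous_intros) auto
  ultimately show ?thesis by simp
qed

lemma best_approx_attained:
  fixes nX :: "real ^ 'n \<Rightarrow> real"
  assumes "is_norm nX"
  shows "\<exists>z\<in>sparse k. best_approx k nX x = nX (x - z) \<and> (\<forall>w\<in>sparse k. nX (x - z) \<le> nX (x - w))"
proof -
  obtain c where c: "c > 0" "\<And>x. c * norm x \<le> nX x"
    using is_norm_lower_bound[OF assms] by blast
  let ?K = "sparse k \<inter> cball x (nX x / c)"
  have zero: "0 \<in> sparse k" by (simp add: sparse_def l0_def)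
  have in_ball: "w \<in> cball x (nX x / c)" if "nX (x - w) \<le> nX x" for w
  proof -
    have "c * dist x w \<le> nX x" using c(2)[of "x - w"] that by (simp add: dist_norm)
    then show ?thesis using c(1) by (simp add: field_simps)
  qed
  have "compact ?K" by (intro closed_Int_compact closed_sparse compact_cball)
  moreover have "?K \<noteq> {}" using zero in_ball[of 0] by auto
  moreover have "continuous_on ?K (\<lambda>z. nX (x - z))"
    by (rule continuous_on_compose2[OF is_norm_continuous[OF assms]])
       (auto intro!: continuous_intros)
  ultimately obtain z where z: "z \<in> ?K" "\<And>w. w \<in> ?K \<Longrightarrow> nX (x - z) \<le> nX (x - w)"
    using continuous_attains_inf[of ?K "\<lambda>z. nX (x - z)"] by blast
  have z_le: "nX (x - z) \<le> nX x"
    using z(2)[of 0] zero in_ball[of 0] by auto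
  have min: "nX (x - z) \<le> nX (x - w)" if "w \<in> sparse k" for w
    using z(2)[of w] that in_ball[of w] z_le by fastforce
  have "best_approx k nX x = nX (x - z)"
    unfolding best_approx_def using z(1) min by (intro cInf_eq_minimum) auto
  then show ?thesis using z(1) min by auto
qed

end

theory Submission
  imports Defs
begin

text \<open>For (i), decode \<open>y\<close> to a vector minimising \<open>\<sigma>\<^sub>k\<close> on the fibre \<open>{z. \<bar>A z\<bar> = y}\<close>. If \<open>x\<close> and \<open>z\<close>
  lie in one fibre, then \<open>\<eta>\<^sub>1 = x - z\<close> and \<open>\<eta>\<^sub>2 = x + z\<close> are annihilated by complementary sets of rows,
  so the hypothesis bounds the distance of \<open>z\<close> from \<open>\<plusminus>x\<close> by the mean of \<open>C\<^sub>0 \<sigma>\<^sub>k(x)\<close> and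
  \<open>C\<^sub>0 \<sigma>\<^sub>k(z)\<close>. The same bound shows that the sublevel sets of \<open>\<sigma>\<^sub>k\<close> in a fibre are bounded,
  whence the minimiser exists.
  For (ii), \<open>\<eta>\<^sub>1 + \<eta>\<^sub>2\<close> and \<open>\<eta>\<^sub>1 - \<eta>\<^sub>2\<close> have the same phaseless measurements, hence the same decoding,
  and the triangle inequality through it gives the claim.\<close>

lemma is_norm_eq_0: "is_norm nX \<Longrightarrow> nX x = 0 \<longleftrightarrow> x = 0"
  and is_norm_scaleR: "is_norm nX \<Longrightarrow> nX (c *\<^sub>R x) = \<bar>c\<bar> * nX x"
  and is_norm_triangle: "is_norm nX \<Longrightarrow> nX (x + y) \<le> nX x + nX y"
  by (simp_all add: is_norm_def)

lemma is_norm_minus: "is_norm nX \<Longrightarrow> nX (- x) = nX x"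
  using is_norm_scaleR[of nX "-1" x] by simp

lemma is_norm_minus_commute: "is_norm nX \<Longrightarrow> nX (x - y) = nX (y - x)"
  using is_norm_minus[of nX "x - y"] by simp

lemma sparse_scaleR: "z \<in> sparse k \<Longrightarrow> c *\<^sub>R z \<in> sparse k"
proof -
  assume z: "z \<in> sparse k"
  have "l0 (c *\<^sub>R z) \<le> l0 z"
    unfolding l0_def by (intro card_mono) auto
  with z show ?thesis
    by (simp add: sparse_def)
qed

lemma best_approx_le:
  assumes "is_norm nX" and "z \<in> sparse k"
  shows "best_approx k nX x \<le> nX (x - z)"
  using best_approx_attained[OF assms(1), of k x] assms(2) by auto

lemma best_approx_scaleR_le:
  assumes "is_norm nX"
  shows "best_approx k nX (c *\<^sub>R x) \<le> \<bar>c\<bar> * best_approx k nX x"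
proof -
  obtain z where z: "z \<in> sparse k" "best_approx k nX x = nX (x - z)"
    using best_approx_attained[OF assms] by blast
  have "best_approx k nX (c *\<^sub>R x) \<le> nX (c *\<^sub>R x - c *\<^sub>R z)"
    by (intro best_approx_le assms sparse_scaleR z)
  also have "\<dots> = \<bar>c\<bar> * nX (x - z)"
    by (simp add: is_norm_scaleR[OF assms] flip: scaleR_diff_right)
  finally show ?thesis
    by (simp add: z)
qed

text \<open>A best sparse approximation of \<open>y\<close> competes in the infimum for
  \<open>x\<close>. Used in both directions, this makes \<open>best_approx k nX\<close> 1-Lipschitz
  for \<open>nX\<close>.\<close>

lemma best_approx_triangle:
  assumes "is_norm nX"
  shows "best_approx k nX x \<le> best_approx k nX y + nX (x - y)"
proof -
  obtain z where z: "z \<in> sparse k" "best_approx k nX y = nX (y - z)"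
    using best_approx_attained[OF assms] by blast
  have "best_approx k nX x \<le> nX (x - z)"
    by (intro best_approx_le assms z)
  also have "\<dots> \<le> nX (y - z) + nX (x - y)"
    using is_norm_triangle[OF assms, of "y - z" "x - y"] by simp
  finally show ?thesis
    by (simp add: z)
qed

text \<open>The Lipschitz bound is in \<open>nX\<close>, the topology Euclidean. They are reconciled
  by continuity of \<open>nX\<close> at 0, so that \<open>nX (x - a)\<close> tends to 0.\<close>

lemma continuous_on_best_approx:
  fixes nX :: "real ^ 'n \<Rightarrow> real"
  assumes "is_norm nX"
  shows "continuous_on UNIV (best_approx k nX)"
  unfolding continuous_on_def
proof
  fix a :: "real ^ 'n"
  have "isCont nX 0"
    using is_norm_continuous[OF assms] by (simp add: continuous_on_eq_continuous_at)
  moreover have "((\<lambda>x. x - a) \<longlongrightarrow> 0) (at a)"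
    by (rule LIM_zero[OF tendsto_ident_at])
  ultimately have "((\<lambda>x. nX (x - a)) \<longlongrightarrow> nX 0) (at a)"
    by (rule isCont_tendsto_compose)
  then have "((\<lambda>x. nX (x - a)) \<longlongrightarrow> 0) (at a)"
    using is_norm_eq_0[OF assms, of 0] by simp
  moreover have "norm (best_approx k nX x - best_approx k nX a) \<le> nX (x - a)" for x
    using best_approx_triangle[OF assms, of k x a] best_approx_triangle[OF assms, of k a x]
      is_norm_minus_commute[OF assms, of a x] unfolding real_norm_def by linarith
  then have "\<forall>\<^sub>F x in at a. norm (best_approx k nX x - best_approx k nX a) \<le> nX (x - a)"
    by (rule always_eventually[OF allI])
  ultimately have "((\<lambda>x. best_approx k nX x - best_approx k nX a) \<longlongrightarrow> 0) (at a)"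
    by (rule Lim_null_comparison[rotated])
  then show "(best_approx k nX \<longlongrightarrow> best_approx k nX a) (at a within UNIV)"
    by (rule LIM_zero_cancel)
qed

text \<open>Closeness to \<open>x\<close> or \<open>- x\<close> bounds \<open>nX z\<close> by
  \<open>r + nX x\<close>, and \<open>nX\<close> dominates a positive multiple of the Euclidean
  norm.\<close>

lemma bounded_near_plus_minus:
  fixes nX :: "'a::euclidean_space \<Rightarrow> real"
  assumes "is_norm nX"
  shows "bounded {z. min (nX (x - z)) (nX (x + z)) \<le> r}"
proof -
  obtain c where c: "c > 0" "\<And>x. c * norm x \<le> nX x"
    using is_norm_lower_bound[OF assms] by blast
  have "norm z \<le> (r + nX x) / c" if "min (nX (x - z)) (nX (x + z)) \<le> r" for z
  proof -
    have "nX z \<le> nX (x - z) + nX x"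
      using is_norm_triangle[OF assms, of "z - x" x] is_norm_minus_commute[OF assms, of x z]
      by simp
    moreover have "nX z \<le> nX (x + z) + nX x"
      using is_norm_triangle[OF assms, of "x + z" "- x"] is_norm_minus[OF assms, of x] by simp
    ultimately have "c * norm z \<le> r + nX x"
      using c(2)[of z] that by linarith
    then show ?thesis
      using c(1) by (simp add: field_simps)
  qed
  then show ?thesis
    by (intro boundedI) auto
qed

lemma abs_vec_eq_iff: "\<bar>x\<bar> = \<bar>y\<bar> \<longleftrightarrow> (\<forall>i. \<bar>x $ i\<bar> = \<bar>y $ i\<bar>)" for x y :: "real ^ 'm"
  by (simp add: abs_vec_def vec_eq_iff)

lemma closed_phaseless_fibre: "closed {z. \<bar>A *v z\<bar> = y}" for A :: "real ^ 'n ^ 'm"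
proof -
  have "{z. \<bar>A *v z\<bar> = y} = (\<Inter>i. {z. \<bar>(A *v z) $ i\<bar> = y $ i})"
    by (auto simp: abs_vec_def vec_eq_iff)
  moreover have "closed {z. \<bar>(A *v z) $ i\<bar> = y $ i}" for i
    by (intro closed_Collect_eq continuous_intros matrix_vector_mult_linear_continuous_on)
  ultimately show ?thesis
    by (simp add: closed_INT)
qed

text \<open>This serves twice: for every \<open>z\<close> in a sublevel set, to bound that set, and
  for a minimiser \<open>z\<close>, as the optimality estimate itself.\<close>

lemma phaseless_fibre_near:
  fixes A :: "real ^ 'n ^ 'm"
  assumes nX: "is_norm nX" and C0: "0 \<le> C0"
    and cond: "\<And>I \<eta>1 \<eta>2. \<eta>1 \<in> null_rows A I \<Longrightarrow> \<eta>2 \<in> null_rows A (- I) \<Longrightarrow>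
      min (nX \<eta>1) (nX \<eta>2)
        \<le> C0 / 4 * best_approx k nX (\<eta>1 - \<eta>2) + C0 / 4 * best_approx k nX (\<eta>1 + \<eta>2)"
    and eq: "\<bar>A *v z\<bar> = \<bar>A *v x\<bar>" and le: "best_approx k nX z \<le> best_approx k nX x"
  shows "min (nX (x - z)) (nX (x + z)) \<le> C0 * best_approx k nX x"
proof -
  let ?\<sigma> = "best_approx k nX"
  \<comment> \<open>The rows where the two measurements agree. In the remaining rows they are
    opposite, since their absolute values coincide.\<close>
  let ?I = "{i. (A *v x) $ i = (A *v z) $ i}"
  have "x - z \<in> null_rows A ?I"
    by (simp add: null_rows_def matrix_vector_mult_diff_distrib)
  moreover have "(A *v x) $ i = (A *v z) $ i \<or> (A *v x) $ i + (A *v z) $ i = 0" for i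
    using eq[unfolded abs_vec_eq_iff, rule_format, of i] by linarith
  then have "x + z \<in> null_rows A (- ?I)"
    by (auto simp: null_rows_def matrix_vector_right_distrib)
  ultimately have "min (nX (x - z)) (nX (x + z))
      \<le> C0 / 4 * ?\<sigma> ((x - z) - (x + z)) + C0 / 4 * ?\<sigma> ((x - z) + (x + z))"
    by (rule cond)
  also have "(x - z) - (x + z) = (-2) *\<^sub>R z"
    by (simp add: scaleR_2)
  also have "(x - z) + (x + z) = 2 *\<^sub>R x"
    by (simp add: scaleR_2)
  \<comment> \<open>Each factor 2 comes out of \<open>best_approx\<close>, and \<open>le\<close>
    replaces \<open>z\<close> by \<open>x\<close>. The two halves then add up to
    \<open>C0 * best_approx k nX x\<close>.\<close>
  also have "C0 / 4 * ?\<sigma> ((-2) *\<^sub>R z) + C0 / 4 * ?\<sigma> (2 *\<^sub>R x)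
      \<le> C0 / 4 * (2 * ?\<sigma> x) + C0 / 4 * (2 * ?\<sigma> x)"
    using best_approx_scaleR_le[OF nX, of k "-2" z] best_approx_scaleR_le[OF nX, of k 2 x] le C0
    by (intro add_mono mult_left_mono) auto
  finally show ?thesis
    by simp
qed

lemma decoder_exists:
  fixes A :: "real ^ 'n ^ 'm"
  assumes nX: "is_norm nX" and C0: "0 \<le> C0"
    and cond: "\<And>I \<eta>1 \<eta>2. \<eta>1 \<in> null_rows A I \<Longrightarrow> \<eta>2 \<in> null_rows A (- I) \<Longrightarrow>
      min (nX \<eta>1) (nX \<eta>2)
        \<le> C0 / 4 * best_approx k nX (\<eta>1 - \<eta>2) + C0 / 4 * best_approx k nX (\<eta>1 + \<eta>2)"
  shows "\<exists>\<Delta>. phaseless_instance_optimal A \<Delta> k C0 nX"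
proof -
  let ?\<sigma> = "best_approx k nX"
  have near: "min (nX (x - z)) (nX (x + z)) \<le> C0 * ?\<sigma> x"
    if "\<bar>A *v z\<bar> = \<bar>A *v x\<bar>" "?\<sigma> z \<le> ?\<sigma> x" for x z
    using nX C0 cond that by (rule phaseless_fibre_near)
  have minimiser: "\<exists>z. \<bar>A *v z\<bar> = \<bar>A *v x\<bar> \<and> (\<forall>w. \<bar>A *v w\<bar> = \<bar>A *v x\<bar> \<longrightarrow> ?\<sigma> z \<le> ?\<sigma> w)"
    for x
  proof -
    \<comment> \<open>Cutting the fibre at the level of \<open>x\<close> makes it compact. Points of
      the fibre outside \<open>?K\<close> have a value above that of \<open>x\<close>, so a
      minimiser on \<open>?K\<close> is one on the whole fibre.\<close>
    let ?K = "{z. \<bar>A *v z\<bar> = \<bar>A *v x\<bar>} \<inter> {z. ?\<sigma> z \<le> ?\<sigma> x}"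
    have "closed ?K"
      by (intro closed_Int closed_phaseless_fibre closed_Collect_le continuous_on_best_approx nX
          continuous_on_const)
    moreover have "bounded ?K"
      by (rule bounded_subset[OF bounded_near_plus_minus[OF nX]]) (auto intro: near)
    ultimately have "compact ?K"
      by (simp add: compact_eq_bounded_closed)
    moreover have "x \<in> ?K"
      by simp
    moreover have "continuous_on ?K ?\<sigma>"
      using continuous_on_best_approx[OF nX] continuous_on_subset by blast
    ultimately obtain z where z: "z \<in> ?K" "\<And>w. w \<in> ?K \<Longrightarrow> ?\<sigma> z \<le> ?\<sigma> w"
      using continuous_attains_inf[of ?K ?\<sigma>] by blast
    have "?\<sigma> z \<le> ?\<sigma> w" if "\<bar>A *v w\<bar> = \<bar>A *v x\<bar>" for w
      using z(1) z(2)[of w] that by (cases "?\<sigma> w \<le> ?\<sigma> x") auto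
    with z(1) show ?thesis
      by blast
  qed
  \<comment> \<open>On an empty fibre the choice is arbitrary; optimality evaluates the decoder only
    at vectors \<open>\<bar>A *v x\<bar>\<close>.\<close>
  define \<Delta> where "\<Delta> y = (SOME z. \<bar>A *v z\<bar> = y \<and> (\<forall>w. \<bar>A *v w\<bar> = y \<longrightarrow> ?\<sigma> z \<le> ?\<sigma> w))" for y
  have "\<bar>A *v \<Delta> \<bar>A *v x\<bar>\<bar> = \<bar>A *v x\<bar> \<and> ?\<sigma> (\<Delta> \<bar>A *v x\<bar>) \<le> ?\<sigma> x" for x
    using someI_ex[OF minimiser[of x]] unfolding \<Delta>_def by blast
  then have "phaseless_instance_optimal A \<Delta> k C0 nX"
    by (simp add: phaseless_instance_optimal_def near)
  then show ?thesis
    by blast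
qed

text \<open>In every row one of the two measurements vanishes, so sum and difference agree there up
  to sign.\<close>

lemma abs_mult_null_rows:
  fixes A :: "real ^ 'n ^ 'm"
  assumes "\<eta>1 \<in> null_rows A I" and "\<eta>2 \<in> null_rows A (- I)"
  shows "\<bar>A *v (\<eta>1 - \<eta>2)\<bar> = \<bar>A *v (\<eta>1 + \<eta>2)\<bar>"
  unfolding abs_vec_eq_iff
proof
  fix i
  have "(A *v \<eta>1) $ i = 0 \<or> (A *v \<eta>2) $ i = 0"
    using assms by (auto simp: null_rows_def)
  then show "\<bar>(A *v (\<eta>1 - \<eta>2)) $ i\<bar> = \<bar>(A *v (\<eta>1 + \<eta>2)) $ i\<bar>"
    by (auto simp: matrix_vector_right_distrib matrix_vector_mult_diff_distrib)
qed

lemma phaseless_instance_optimal_null_rows: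
  fixes A :: "real ^ 'n ^ 'm"
  assumes nX: "is_norm nX" and opt: "phaseless_instance_optimal A \<Delta> k C0 nX"
    and \<eta>: "\<eta>1 \<in> null_rows A I" "\<eta>2 \<in> null_rows A (- I)"
  shows "min (nX \<eta>1) (nX \<eta>2)
    \<le> C0 / 2 * best_approx k nX (\<eta>1 - \<eta>2) + C0 / 2 * best_approx k nX (\<eta>1 + \<eta>2)"
proof -
  define x y where "x = \<eta>1 + \<eta>2" and "y = \<eta>1 - \<eta>2"
  define d where "d = \<Delta> \<bar>A *v x\<bar>"
  have "\<bar>A *v y\<bar> = \<bar>A *v x\<bar>"
    unfolding x_def y_def by (rule abs_mult_null_rows[OF \<eta>])
  then have min_x: "min (nX (x - d)) (nX (x + d)) \<le> C0 * best_approx k nX x"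
    and min_y: "min (nX (y - d)) (nX (y + d)) \<le> C0 * best_approx k nX y"
    using opt unfolding phaseless_instance_optimal_def d_def by metis+
  have "x + y = 2 *\<^sub>R \<eta>1" "x - y = 2 *\<^sub>R \<eta>2"
    by (simp_all add: x_def y_def scaleR_2)
  then have sums: "nX (x + y) = 2 * nX \<eta>1" "nX (x - y) = 2 * nX \<eta>2"
    by (simp_all add: is_norm_scaleR[OF nX])
  \<comment> \<open>Four cases, by which of \<open>d\<close> and \<open>- d\<close> is the nearer to
    \<open>x\<close> and to \<open>y\<close>. The same sign bounds \<open>x - y\<close>, that is,
    twice \<open>\<eta>2\<close>; opposite signs bound \<open>x + y\<close>, twice
    \<open>\<eta>1\<close>. Halving gives the constant \<open>C0 / 2\<close>.\<close>
  have "nX (x - y) \<le> nX (x - d) + nX (y - d)"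
    using is_norm_triangle[OF nX, of "x - d" "d - y"] is_norm_minus_commute[OF nX, of d y] by simp
  moreover have "nX (x - y) \<le> nX (x + d) + nX (y + d)"
    using is_norm_triangle[OF nX, of "x + d" "- (y + d)"] is_norm_minus[OF nX, of "y + d"] by simp
  moreover have "nX (x + y) \<le> nX (x - d) + nX (y + d)"
    using is_norm_triangle[OF nX, of "x - d" "y + d"] by simp
  moreover have "nX (x + y) \<le> nX (x + d) + nX (y - d)"
    using is_norm_triangle[OF nX, of "x + d" "y - d"] by simp
  ultimately have "2 * min (nX \<eta>1) (nX \<eta>2) \<le> C0 * best_approx k nX y + C0 * best_approx k nX x"
    using min_x min_y sums by linarith
  then show ?thesis
    by (simp add: x_def y_def)
qed

theorem theorem4p2:
  fixes A :: "real ^ 'n ^ 'm" and k :: nat and nX :: "real ^ 'n \<Rightarrow> real" and C0 :: real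
  assumes "1 \<le> k" and "k \<le> CARD('n)" and "is_norm nX" and "C0 > 0"
  shows "((\<forall>I. \<forall>\<eta>1\<in>null_rows A I. \<forall>\<eta>2\<in>null_rows A (- I).
             min (nX \<eta>1) (nX \<eta>2)
               \<le> C0 / 4 * best_approx k nX (\<eta>1 - \<eta>2) + C0 / 4 * best_approx k nX (\<eta>1 + \<eta>2))
          \<longrightarrow> (\<exists>\<Delta> :: real ^ 'm \<Rightarrow> real ^ 'n. phaseless_instance_optimal A \<Delta> k C0 nX))
       \<and> ((\<exists>\<Delta> :: real ^ 'm \<Rightarrow> real ^ 'n. phaseless_instance_optimal A \<Delta> k C0 nX)
          \<longrightarrow> (\<forall>I. \<forall>\<eta>1\<in>null_rows A I. \<forall>\<eta>2\<in>null_rows A (- I).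
             min (nX \<eta>1) (nX \<eta>2)
               \<le> C0 / 2 * best_approx k nX (\<eta>1 - \<eta>2) + C0 / 2 * best_approx k nX (\<eta>1 + \<eta>2)))"
proof (intro conjI impI allI ballI)
  assume "\<forall>I. \<forall>\<eta>1\<in>null_rows A I. \<forall>\<eta>2\<in>null_rows A (- I). min (nX \<eta>1) (nX \<eta>2)
    \<le> C0 / 4 * best_approx k nX (\<eta>1 - \<eta>2) + C0 / 4 * best_approx k nX (\<eta>1 + \<eta>2)"
  with assms show "\<exists>\<Delta>. phaseless_instance_optimal A \<Delta> k C0 nX"
    by (intro decoder_exists) auto
next
  fix I \<eta>1 \<eta>2
  assume "\<exists>\<Delta>. phaseless_instance_optimal A \<Delta> k C0 nX"
    and "\<eta>1 \<in> null_rows A I" "\<eta>2 \<in> null_rows A (- I)"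
  then show "min (nX \<eta>1) (nX \<eta>2)
    \<le> C0 / 2 * best_approx k nX (\<eta>1 - \<eta>2) + C0 / 2 * best_approx k nX (\<eta>1 + \<eta>2)"
    using phaseless_instance_optimal_null_rows[OF assms(3)] by blast
qed

end
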